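(* The proportion of the Latin squares in the ensemble of an $\mathrm{OA}(k,n)$ that are equiparity is no more than $\frac14+o(1)$ as $n,k\to\infty$ with $n\equiv 2,3\pmod 4$. That is, for every $\varepsilon>0$ there is $K_0$ such that for all integers $n,k\ge K_0$ with $3\le k\le n+1$ and $n\equiv 2$ or $3\pmod 4$, and for every $\mathrm{OA}(k,n)$, at most $\left(\frac14+\varepsilon\right)\binom{k}{3}$ of the $\binom{k}{3}$ Latin squares in its ensemble are equiparity.
   Context: An orthogonal array $\mathrm{OA}(k,n)$ on an alphabet $\Lambda$ with $|\Lambda|=n$ is an $n^2\times k$ matrix $A=(a_{r\ell})$ with entries in $\Lambda$ such that in every pair of distinct columns each ordered pair in $\Lambda^2$ occurs in exactly one row. The ensemble of $A$ is the family of Latin squares indexed by the $\binom{k}{3}$ choices of columns $i<j<\ell$ of $A$ (Latin squares are counted once for each choice of three columns): the Latin square for $i<j<\ell$ has rows and columns indexed by $\Lambda$, and for each row $r$ of $A$ its entry in row $a_{ri}$, column $a_{rj}$ is $a_{r\ell}$. For a Latin square $L=(l_{xy})$ with rows, columns and symbols indexed by $\Lambda$, the row-parity $\pi_r\in\mathbb{Z}_2$ is the sum of the parities ($0$ even, $1$ odd) of the $n$ permutations $y\mapsto l_{xy}$ ($x\in\Lambda$ fixed); the column-parity $\pi_c$ is the sum of the parities of the $n$ permutations $x\mapsto l_{xy}$ ($y$ fixed); the symbol-parity $\pi_s$ is the sum of the parities of the $n$ permutations mapping $x\mapsto y$ whenever $l_{xy}=s$ ($s$ fixed). $L$ is equiparity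 if $\pi_r=\pi_c=\pi_s$. *)

theory Defs
  imports Complex_Main "HOL-Combinatorics.Combinatorics" "HOL-Library.Z2"
begin

(* Matrices are functions of a row and a column index, both counted from 0; only the
   entries A r c with r < n^2 and c < k are relevant. *)
definition orthogonal_array :: "'a set \<Rightarrow> nat \<Rightarrow> nat \<Rightarrow> (nat \<Rightarrow> nat \<Rightarrow> 'a) \<Rightarrow> bool" where
  "orthogonal_array \<Lambda> k n A \<longleftrightarrow>
     finite \<Lambda> \<and> card \<Lambda> = n \<and>
     (\<forall>r<n^2. \<forall>c<k. A r c \<in> \<Lambda>) \<and>
     (\<forall>c<k. \<forall>d<k. c \<noteq> d \<longrightarrow>
        (\<forall>x\<in>\<Lambda>. \<forall>y\<in>\<Lambda>. \<exists>!r. r < n^2 \<and> A r c = x \<and> A r d = y))"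

(* The Latin square of the columns i, j, l: its entry in row x, column y is A r l for
   the unique row r of the array with A r i = x and A r j = y. *)
definition oa_square :: "nat \<Rightarrow> (nat \<Rightarrow> nat \<Rightarrow> 'a) \<Rightarrow> nat \<Rightarrow> nat \<Rightarrow> nat \<Rightarrow> 'a \<Rightarrow> 'a \<Rightarrow> 'a" where
  "oa_square n A i j l x y = A (THE r. r < n^2 \<and> A r i = x \<and> A r j = y) l"

(* The ensemble is a family, not a set: equal squares arising from different choices of
   columns are counted separately. These triples are its indices. *)
definition column_triples :: "nat \<Rightarrow> (nat \<times> nat \<times> nat) set" where
  "column_triples k = {(i, j, l). i < j \<and> j < l \<and> l < k}"

(* Parity in the integers modulo 2 of a permutation f of S. As evenperm is a predicate on
   permutations of the whole type, f is extended by the identity outside S. *)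
definition perm_parity :: "'a set \<Rightarrow> ('a \<Rightarrow> 'a) \<Rightarrow> bit" where
  "perm_parity S f = (if evenperm (perm_restrict f S) then 0 else 1)"

definition row_parity :: "'a set \<Rightarrow> ('a \<Rightarrow> 'a \<Rightarrow> 'a) \<Rightarrow> bit" where
  "row_parity \<Lambda> L = (\<Sum>x\<in>\<Lambda>. perm_parity \<Lambda> (\<lambda>y. L x y))"

definition column_parity :: "'a set \<Rightarrow> ('a \<Rightarrow> 'a \<Rightarrow> 'a) \<Rightarrow> bit" where
  "column_parity \<Lambda> L = (\<Sum>y\<in>\<Lambda>. perm_parity \<Lambda> (\<lambda>x. L x y))"

definition symbol_parity :: "'a set \<Rightarrow> ('a \<Rightarrow> 'a \<Rightarrow> 'a) \<Rightarrow> bit" where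
  "symbol_parity \<Lambda> L = (\<Sum>s\<in>\<Lambda>. perm_parity \<Lambda> (\<lambda>x. THE y. y \<in> \<Lambda> \<and> L x y = s))"

definition equiparity :: "'a set \<Rightarrow> ('a \<Rightarrow> 'a \<Rightarrow> 'a) \<Rightarrow> bool" where
  "equiparity \<Lambda> L \<longleftrightarrow>
     row_parity \<Lambda> L = column_parity \<Lambda> L \<and> column_parity \<Lambda> L = symbol_parity \<Lambda> L"

end

theory Submission
  imports Defs
begin

text \<open>
  For a column \<open>i\<close>, summing over the symbols \<open>x\<close> the parity of the permutation that takes
  column \<open>j\<close> to column \<open>l\<close> on the rows with \<open>x\<close> in column \<open>i\<close> gives \<open>R i j l\<close>; the
  three parities of the square of \<open>i, j, l\<close> are \<open>R i j l\<close>, \<open>R j i l\<close>, \<open>R l i j\<close>.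
  Identifying rows of the array with \<open>\<Lambda> \<times> \<Lambda>\<close> through pairs of columns, these three permutations
  compose to the identity once three coordinate swaps are inserted, so they add up to
  \<open>n choose 2\<close>, which is odd here. Hence each square has one or three odd parities.
  For fixed \<open>i\<close>, \<open>R i j l\<close> is a coboundary, so \<open>(-1)\<^bsup>R i j l\<^esup> = \<sigma> j * \<sigma> l\<close> and the sum of
  these signs over \<open>j \<noteq> l\<close> is a square minus \<open>k - 1\<close>. An equiparity square contributes \<open>-3\<close> to the
  sum of all signs and any other square \<open>1\<close>, so at most about a quarter can be equiparity.
\<close>

section \<open>Parity of permutations of a finite set\<close>

lemma perm_restrict_permutes:
  assumes "bij_betw f S S"
  shows "perm_restrict f S permutes S"
proof (rule bij_imp_permutes)
  show "bij_betw (perm_restrict f S) S S"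
    using assms by (subst bij_betw_cong[where g = f]) (auto simp: perm_restrict_def)
qed (auto simp: perm_restrict_def)

lemma permutation_perm_restrict:
  assumes "finite S" "bij_betw f S S"
  shows "permutation (perm_restrict f S)"
  using assms perm_restrict_permutes permutation_permutes by blast

lemma perm_parity_cong:
  assumes "\<And>x. x \<in> S \<Longrightarrow> f x = g x"
  shows "perm_parity S f = perm_parity S g"
proof -
  have "perm_restrict f S = perm_restrict g S"
    using assms by (auto simp: perm_restrict_def fun_eq_iff)
  then show ?thesis by (simp add: perm_parity_def)
qed

lemma perm_parity_ident:
  assumes "\<And>x. x \<in> S \<Longrightarrow> f x = x"
  shows "perm_parity S f = 0"
proof -
  have "perm_restrict f S = id"
    using assms by (auto simp: perm_restrict_def fun_eq_iff)
  then show ?thesis by (simp add: perm_parity_def)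
qed

lemma perm_parity_empty [simp]: "perm_parity {} f = 0"
  by (rule perm_parity_ident) simp

lemma perm_parity_comp:
  assumes "finite S" "bij_betw f S S" "bij_betw g S S"
  shows "perm_parity S (f \<circ> g) = perm_parity S f + perm_parity S g"
proof -
  have "perm_restrict (f \<circ> g) S = perm_restrict f S \<circ> perm_restrict g S"
    using assms(3) by (auto simp: perm_restrict_def fun_eq_iff bij_betw_def)
  then show ?thesis
    using evenperm_comp[OF permutation_perm_restrict[OF assms(1,2)] permutation_perm_restrict[OF assms(1,3)]]
    by (simp add: perm_parity_def)
qed

lemma perm_parity_Un:
  assumes "finite A" "finite B" "A \<inter> B = {}" "bij_betw f A A" "bij_betw f B B"
  shows "perm_parity (A \<union> B) f = perm_parity A f + perm_parity B f"
proof -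
  have "perm_restrict f A \<circ> perm_restrict f B = perm_restrict f (A \<union> B)"
    using assms by (intro perm_restrict_union perm_restrict_permutes)
  moreover have "evenperm (perm_restrict f A \<circ> perm_restrict f B) \<longleftrightarrow>
      (evenperm (perm_restrict f A) \<longleftrightarrow> evenperm (perm_restrict f B))"
    using assms by (intro evenperm_comp permutation_perm_restrict)
  ultimately show ?thesis by (simp add: perm_parity_def)
qed

text \<open>Carrying \<open>f\<close> along \<open>h\<close> is conjugation, which keeps the cycle
  type. \<open>S\<close> and \<open>T\<close> may have different types, so a fibre of a product can
  be compared with its second factor.\<close>

lemma perm_parity_conjugate:
  assumes "finite S" "bij_betw h S T" "bij_betw f S S" "\<And>x. x \<in> S \<Longrightarrow> g (h x) = h (f x)"
  shows "perm_parity T g = perm_parity S f"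
proof -
  have inj: "inj_on h S" and T: "T = h ` S"
    using assms(2) by (auto simp: bij_betw_def)
  have "map_permutation S h (perm_restrict f S) = perm_restrict g T"
  proof
    fix y
    show "map_permutation S h (perm_restrict f S) y = perm_restrict g T y"
    proof (cases "y \<in> T")
      case True
      then obtain x where "x \<in> S" "y = h x" using T by auto
      then show ?thesis
        using True assms(4) by (simp add: map_permutation_apply[OF inj] perm_restrict_def)
    next
      case False
      then show ?thesis by (simp add: map_permutation_def T perm_restrict_def)
    qed
  qed
  moreover have "evenperm (map_permutation S h (perm_restrict f S)) = evenperm (perm_restrict f S)"
    using evenperm_map_permutation[OF inj perm_restrict_permutes[OF assms(3)] assms(1)] .
  ultimately show ?thesis by (simp add: perm_parity_def)
qed

section \<open>Permutations of a product set\<close>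

lemma bij_betw_fibrewise:
  assumes "\<And>i. i \<in> I \<Longrightarrow> bij_betw (F i) S S"
  shows "bij_betw (\<lambda>(i, x). (i, F i x)) (I \<times> S) (I \<times> S)"
proof (rule bij_betw_imageI)
  show "inj_on (\<lambda>(i, x). (i, F i x)) (I \<times> S)"
    using assms by (auto simp: inj_on_def bij_betw_def)
  show "(\<lambda>(i, x). (i, F i x)) ` (I \<times> S) = I \<times> S"
  proof (intro equalityI subsetI)
    fix p assume "p \<in> I \<times> S"
    then obtain i y where p: "p = (i, y)" "i \<in> I" "y \<in> S" by auto
    then obtain x where "x \<in> S" "y = F i x"
      using assms[of i] by (auto simp: bij_betw_def)
    then show "p \<in> (\<lambda>(i, x). (i, F i x)) ` (I \<times> S)"
      using p by (auto intro!: image_eqI[of _ _ "(i, x)"])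
  qed (use assms in \<open>auto simp: bij_betw_def\<close>)
qed

text \<open>Each fibre \<open>{i} \<times> S\<close> is a copy of \<open>S\<close> on which
  \<open>F i\<close> acts, and parities on disjoint pieces add. This turns the sum defining a
  row-parity into one parity on \<open>\<Lambda> \<times> \<Lambda>\<close>.\<close>

lemma perm_parity_fibrewise:
  assumes "finite I" "finite S" "\<And>i. i \<in> I \<Longrightarrow> bij_betw (F i) S S"
  shows "perm_parity (I \<times> S) (\<lambda>(i, x). (i, F i x)) = (\<Sum>i\<in>I. perm_parity S (F i))"
  using assms(1,3)
proof (induction I rule: finite_induct)
  case empty
  then show ?case by simp
next
  case (insert i I)
  let ?f = "\<lambda>(i, x). (i, F i x)"
  have "perm_parity ({i} \<times> S) ?f = perm_parity S (F i)"
    using insert.prems assms(2)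
    by (intro perm_parity_conjugate[where h = "Pair i"]) (auto simp: bij_betw_def inj_on_def)
  moreover have "perm_parity (({i} \<times> S) \<union> (I \<times> S)) ?f
      = perm_parity ({i} \<times> S) ?f + perm_parity (I \<times> S) ?f"
    using insert assms(2) by (intro perm_parity_Un bij_betw_fibrewise) auto
  moreover have "insert i I \<times> S = ({i} \<times> S) \<union> (I \<times> S)" by auto
  ultimately show ?case
    using insert by (simp del: add_bit_eq_xor)
qed

text \<open>\<open>A\<close> holds one point of each 2-cycle, so \<open>f\<close> acts as
  \<open>card A\<close> disjoint transpositions.\<close>

lemma perm_parity_involution:
  assumes "finite A" "inj_on f A" "A \<inter> f ` A = {}" "\<And>x. x \<in> A \<Longrightarrow> f (f x) = x"
  shows "perm_parity (A \<union> f ` A) f = of_nat (card A)"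
  using assms
proof (induction A rule: finite_induct)
  case empty
  then show ?case by simp
next
  case (insert a A)
  have bij: "bij_betw f (B \<union> f ` B) (B \<union> f ` B)" if "B \<subseteq> insert a A" for B
  proof (rule bij_betw_byWitness[where f' = f])
  qed (use that insert.prems(3) in \<open>auto simp: subset_iff\<close>)
  have "perm_restrict f {a, f a} = transpose a (f a)"
    using insert.prems(3)[of a] by (auto simp: perm_restrict_def fun_eq_iff transpose_def)
  then have two: "perm_parity {a, f a} f = 1"
    using insert.prems(2) by (auto simp: perm_parity_def evenperm_swap)
  have "perm_parity ({a, f a} \<union> (A \<union> f ` A)) f
      = perm_parity {a, f a} f + perm_parity (A \<union> f ` A) f"
  proof (rule perm_parity_Un)
    have "f a \<notin> f ` A" using insert.prems(1) insert.hyps by auto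
    then show "{a, f a} \<inter> (A \<union> f ` A) = {}"
      using insert.prems insert.hyps by auto
  qed (use insert.hyps bij[of "{a}"] bij[of A] in \<open>auto simp: insert_commute\<close>)
  moreover have "insert a A \<union> f ` insert a A = {a, f a} \<union> (A \<union> f ` A)" by auto
  moreover have "perm_parity (A \<union> f ` A) f = of_nat (card A)"
    using insert by auto
  ultimately show ?case
    using two insert.hyps by (simp del: add_bit_eq_xor)
qed

text \<open>The diagonal is fixed and the 2-cycles correspond to the unordered pairs of distinct
  elements. In the induction a new \<open>a\<close> brings the fixed point \<open>(a, a)\<close> and
  \<open>card S\<close> transpositions, which is Pascal's rule.\<close>

lemma perm_parity_swap:
  assumes "finite S"
  shows "perm_parity (S \<times> S) prod.swap = of_nat (card S choose 2)"
  using assms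
proof (induction S rule: finite_induct)
  case empty
  then show ?case by (simp add: numeral_2_eq_2)
next
  case (insert a S)
  let ?A = "{a} \<times> S"
  let ?C = "?A \<union> prod.swap ` ?A"
  have bij: "bij_betw prod.swap B B" if "prod.swap ` B \<subseteq> B" for B :: "('a \<times> 'a) set"
    by (rule bij_betw_byWitness[where f' = prod.swap]) (use that in auto)
  have eq: "insert a S \<times> insert a S = {(a, a)} \<union> (S \<times> S \<union> ?C)"
    by (auto simp: image_iff)
  have "perm_parity (insert a S \<times> insert a S) prod.swap
      = perm_parity {(a, a)} prod.swap + perm_parity (S \<times> S \<union> ?C) prod.swap"
    unfolding eq using insert.hyps by (intro perm_parity_Un bij) auto
  also have "perm_parity (S \<times> S \<union> ?C) prod.swap
      = perm_parity (S \<times> S) prod.swap + perm_parity ?C prod.swap"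
    using insert.hyps by (intro perm_parity_Un bij) auto
  also have "perm_parity ?C prod.swap = of_nat (card ?A)"
    using insert.hyps by (intro perm_parity_involution) (auto simp: inj_on_def)
  also have "card ?A = card S" by (simp add: card_cartesian_product_singleton)
  also have "perm_parity {(a, a)} prod.swap = 0" by (rule perm_parity_ident) auto
  finally show ?case
    using insert.IH insert.hyps
    by (simp add: numeral_2_eq_2 add.commute del: add_bit_eq_xor)
qed

section \<open>Comparing two bijections from one set onto another\<close>

definition relative_parity :: "'r set \<Rightarrow> 'b set \<Rightarrow> ('r \<Rightarrow> 'b) \<Rightarrow> ('r \<Rightarrow> 'b) \<Rightarrow> bit" where
  "relative_parity X Y g h = perm_parity Y (h \<circ> inv_into X g)"

text \<open>On \<open>Y\<close>, the permutation taking \<open>f\<close> to \<open>h\<close> is the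
  one taking \<open>f\<close> to \<open>g\<close> followed by the one taking \<open>g\<close> to
  \<open>h\<close>, and parity is a homomorphism.\<close>

lemma relative_parity_trans:
  assumes "finite Y" "bij_betw f X Y" "bij_betw g X Y" "bij_betw h X Y"
  shows "relative_parity X Y f h = relative_parity X Y f g + relative_parity X Y g h"
proof -
  have "perm_parity Y (h \<circ> inv_into X f) = perm_parity Y ((h \<circ> inv_into X g) \<circ> (g \<circ> inv_into X f))"
  proof (rule perm_parity_cong)
    fix y assume "y \<in> Y"
    then have "inv_into X f y \<in> X"
      using assms(2) by (auto simp: bij_betw_def inv_into_into)
    then show "(h \<circ> inv_into X f) y = ((h \<circ> inv_into X g) \<circ> (g \<circ> inv_into X f)) y"
      using assms(3) by (simp add: bij_betw_def)
  qed
  also have "\<dots> = perm_parity Y (h \<circ> inv_into X g) + perm_parity Y (g \<circ> inv_into X f)"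
    using assms by (intro perm_parity_comp bij_betw_trans[OF bij_betw_inv_into]) auto
  finally show ?thesis by (simp only: relative_parity_def add.commute)
qed

lemma relative_parity_refl:
  assumes "bij_betw f X Y"
  shows "relative_parity X Y f f = 0"
  unfolding relative_parity_def
  by (rule perm_parity_ident) (use assms in \<open>auto simp: bij_betw_def f_inv_into_f\<close>)

text \<open>Going from \<open>f\<close> to \<open>g\<close> and back gives 0, and every bit is its
  own negative.\<close>

lemma relative_parity_sym:
  assumes "finite Y" "bij_betw f X Y" "bij_betw g X Y"
  shows "relative_parity X Y f g = relative_parity X Y g f"
proof -
  have "relative_parity X Y f g + relative_parity X Y g f = 0"
    using relative_parity_trans[OF assms(1,2,3,2)] relative_parity_refl[OF assms(2)] by simp
  then show ?thesis by (cases "relative_parity X Y f g"; cases "relative_parity X Y g f") auto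
qed

section \<open>Parities in the ensemble of an orthogonal array\<close>

definition column_pair :: "(nat \<Rightarrow> nat \<Rightarrow> 'a) \<Rightarrow> nat \<Rightarrow> nat \<Rightarrow> nat \<Rightarrow> 'a \<times> 'a" where
  "column_pair A i j r = (A r i, A r j)"

text \<open>Existence of a row gives surjectivity, uniqueness gives injectivity. In this form the
  labellings of the rows by different pairs of columns can be compared through
  \<open>relative_parity\<close>.\<close>

lemma bij_betw_column_pair:
  assumes "orthogonal_array \<Lambda> k n A" "i < k" "j < k" "i \<noteq> j"
  shows "bij_betw (column_pair A i j) {..<n^2} (\<Lambda> \<times> \<Lambda>)"
proof -
  have ex1: "\<exists>!r. r < n^2 \<and> A r i = x \<and> A r j = y" if "x \<in> \<Lambda>" "y \<in> \<Lambda>" for x y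
    using assms that unfolding orthogonal_array_def by blast
  have mem: "A r i \<in> \<Lambda>" "A r j \<in> \<Lambda>" if "r < n^2" for r
    using assms that unfolding orthogonal_array_def by blast+
  show ?thesis
  proof (rule bij_betw_imageI)
    show "inj_on (column_pair A i j) {..<n^2}"
    proof (rule inj_onI)
      fix r s assume "r \<in> {..<n^2}" "s \<in> {..<n^2}" "column_pair A i j r = column_pair A i j s"
      then show "r = s" using ex1[OF mem[of r]] by (auto simp: column_pair_def)
    qed
    show "column_pair A i j ` {..<n^2} = \<Lambda> \<times> \<Lambda>"
    proof (intro equalityI subsetI)
      fix p assume "p \<in> \<Lambda> \<times> \<Lambda>"
      then obtain x y where p: "p = (x, y)" "x \<in> \<Lambda>" "y \<in> \<Lambda>" by auto
      then obtain r where "r < n^2" "A r i = x" "A r j = y" using ex1 by blast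
      then show "p \<in> column_pair A i j ` {..<n^2}"
        using p by (auto simp: column_pair_def)
    qed (auto simp: column_pair_def mem)
  qed
qed

lemma oa_square_eqI:
  assumes "orthogonal_array \<Lambda> k n A" "i < k" "j < k" "i \<noteq> j" "r < n^2" "A r i = x" "A r j = y"
  shows "oa_square n A i j l x y = A r l"
proof -
  have "(THE r. r < n^2 \<and> A r i = x \<and> A r j = y) = r"
  proof (rule the_equality)
    fix s assume "s < n^2 \<and> A s i = x \<and> A s j = y"
    then show "s = r"
      using bij_betw_column_pair[OF assms(1-4)] assms(5-)
      by (auto simp: bij_betw_def inj_on_def column_pair_def)
  qed (use assms in auto)
  then show ?thesis by (simp add: oa_square_def)
qed

lemma row_with:
  assumes "orthogonal_array \<Lambda> k n A" "i < k" "j < k" "i \<noteq> j" "x \<in> \<Lambda>" "y \<in> \<Lambda>"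
  obtains r where "r < n^2" "A r i = x" "A r j = y"
  using assms unfolding orthogonal_array_def by blast

text \<open>A single array row carries \<open>x\<close>, \<open>y\<close> and the resulting symbol
  in columns \<open>i\<close>, \<open>j\<close>, \<open>l\<close>; exchanging \<open>j\<close> and
  \<open>l\<close> reads it backwards.\<close>

lemma oa_square_inverse:
  assumes oa: "orthogonal_array \<Lambda> k n A" and "i < k" "j < k" "l < k" "i \<noteq> j" "i \<noteq> l" "j \<noteq> l"
    and "x \<in> \<Lambda>" "y \<in> \<Lambda>"
  shows "oa_square n A i j l x y \<in> \<Lambda>"
    and "oa_square n A i l j x (oa_square n A i j l x y) = y"
proof -
  obtain r where r: "r < n^2" "A r i = x" "A r j = y"
    using row_with[OF oa \<open>i < k\<close> \<open>j < k\<close> \<open>i \<noteq> j\<close> \<open>x \<in> \<Lambda>\<close> \<open>y \<in> \<Lambda>\<close>] .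
  have eq: "oa_square n A i j l x y = A r l"
    using assms r by (intro oa_square_eqI) auto
  show "oa_square n A i j l x y \<in> \<Lambda>"
    using eq oa r \<open>l < k\<close> by (simp add: orthogonal_array_def)
  have "oa_square n A i l j x (A r l) = A r j"
    using assms r by (intro oa_square_eqI) auto
  then show "oa_square n A i l j x (oa_square n A i j l x y) = y"
    using eq r by simp
qed

lemma bij_betw_oa_square:
  assumes "orthogonal_array \<Lambda> k n A" "i < k" "j < k" "l < k" "i \<noteq> j" "i \<noteq> l" "j \<noteq> l" "x \<in> \<Lambda>"
  shows "bij_betw (oa_square n A i j l x) \<Lambda> \<Lambda>"
  by (rule bij_betw_byWitness[where f' = "oa_square n A i l j x"])
    (use assms oa_square_inverse[OF assms(1)] in auto)

text \<open>Passing from the label in columns \<open>i, j\<close> to the label in columns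
  \<open>i, l\<close> keeps the first coordinate \<open>x\<close> and applies row \<open>x\<close>
  of the square to the second, so \<open>perm_parity_fibrewise\<close> sums exactly the row
  permutations.\<close>

lemma row_parity_oa_square:
  assumes oa: "orthogonal_array \<Lambda> k n A" and "i < k" "j < k" "l < k" "i \<noteq> j" "i \<noteq> l" "j \<noteq> l"
  shows "row_parity \<Lambda> (oa_square n A i j l)
    = relative_parity {..<n^2} (\<Lambda> \<times> \<Lambda>) (column_pair A i j) (column_pair A i l)"
proof -
  let ?g = "column_pair A i j"
  have fin: "finite \<Lambda>" using oa by (simp add: orthogonal_array_def)
  have "relative_parity {..<n^2} (\<Lambda> \<times> \<Lambda>) ?g (column_pair A i l)
      = perm_parity (\<Lambda> \<times> \<Lambda>) (\<lambda>(x, y). (x, oa_square n A i j l x y))"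
    unfolding relative_parity_def
  proof (rule perm_parity_cong)
    fix p assume p: "p \<in> \<Lambda> \<times> \<Lambda>"
    define r where "r = inv_into {..<n^2} ?g p"
    have img: "?g ` {..<n^2} = \<Lambda> \<times> \<Lambda>"
      using bij_betw_column_pair[OF oa, of i j] assms by (simp add: bij_betw_def)
    have "r < n^2" using inv_into_into[of p ?g "{..<n^2}"] p img by (simp add: r_def)
    moreover have "?g r = p" unfolding r_def using p img by (intro f_inv_into_f) simp
    ultimately show "(column_pair A i l \<circ> inv_into {..<n^2} ?g) p
        = (\<lambda>(x, y). (x, oa_square n A i j l x y)) p"
      using assms oa_square_eqI[OF oa, of i j r]
      by (auto simp: column_pair_def simp flip: r_def)
  qed
  also have "\<dots> = row_parity \<Lambda> (oa_square n A i j l)"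
    unfolding row_parity_def using assms fin
    by (intro perm_parity_fibrewise bij_betw_oa_square) auto
  finally show ?thesis ..
qed

lemma column_parity_oa_square:
  "column_parity \<Lambda> (oa_square n A i j l) = row_parity \<Lambda> (oa_square n A j i l)"
  unfolding column_parity_def row_parity_def oa_square_def by (simp add: conj_commute)

text \<open>The array row with \<open>s\<close> in column \<open>l\<close> and \<open>x\<close> in
  column \<open>i\<close> shows in column \<open>j\<close> the place where row \<open>x\<close> of
  the square holds \<open>s\<close>.\<close>

lemma symbol_parity_oa_square:
  assumes oa: "orthogonal_array \<Lambda> k n A" and "i < k" "j < k" "l < k" "i \<noteq> j" "i \<noteq> l" "j \<noteq> l"
  shows "symbol_parity \<Lambda> (oa_square n A i j l) = row_parity \<Lambda> (oa_square n A l i j)"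
  unfolding symbol_parity_def row_parity_def
proof (intro sum.cong perm_parity_cong refl)
  fix s x assume sx: "s \<in> \<Lambda>" "x \<in> \<Lambda>"
  then obtain r where r: "r < n^2" "A r l = s" "A r i = x"
    using row_with[OF oa, of l i s x] assms by blast
  have mem: "A r j \<in> \<Lambda>" using oa r assms by (simp add: orthogonal_array_def)
  have "(THE y. y \<in> \<Lambda> \<and> oa_square n A i j l x y = s) = A r j"
  proof (rule the_equality)
    have "oa_square n A i j l x (A r j) = A r l"
      using assms r by (intro oa_square_eqI) auto
    then show "A r j \<in> \<Lambda> \<and> oa_square n A i j l x (A r j) = s" using mem r by simp
    then show "y = A r j" if "y \<in> \<Lambda> \<and> oa_square n A i j l x y = s" for y
      using that bij_betw_oa_square[OF assms sx(2)] by (auto simp: bij_betw_def inj_on_def)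
  qed
  also have "\<dots> = oa_square n A l i j s x"
    using assms r by (intro oa_square_eqI[symmetric]) auto
  finally show "(THE y. y \<in> \<Lambda> \<and> oa_square n A i j l x y = s) = oa_square n A l i j s x" .
qed

lemma relative_parity_swap:
  assumes oa: "orthogonal_array \<Lambda> k n A" and "i < k" "j < k" "i \<noteq> j"
  shows "relative_parity {..<n^2} (\<Lambda> \<times> \<Lambda>) (column_pair A i j) (column_pair A j i)
    = of_nat (n choose 2)"
proof -
  let ?g = "column_pair A i j"
  have img: "?g ` {..<n^2} = \<Lambda> \<times> \<Lambda>"
    using bij_betw_column_pair[OF assms] by (simp add: bij_betw_def)
  have "perm_parity (\<Lambda> \<times> \<Lambda>) (column_pair A j i \<circ> inv_into {..<n^2} ?g)
      = perm_parity (\<Lambda> \<times> \<Lambda>) prod.swap"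
  proof (rule perm_parity_cong)
    fix p assume "p \<in> \<Lambda> \<times> \<Lambda>"
    then have "?g (inv_into {..<n^2} ?g p) = p" using img by (intro f_inv_into_f) simp
    moreover have "column_pair A j i r = prod.swap (?g r)" for r
      by (simp add: column_pair_def)
    ultimately show "(column_pair A j i \<circ> inv_into {..<n^2} ?g) p = prod.swap p" by simp
  qed
  moreover have "finite \<Lambda>" "card \<Lambda> = n" using oa by (auto simp: orthogonal_array_def)
  ultimately show ?thesis by (simp add: relative_parity_def perm_parity_swap)
qed

lemma row_parity_oa_square_sym:
  assumes "orthogonal_array \<Lambda> k n A" "i < k" "j < k" "l < k" "i \<noteq> j" "i \<noteq> l" "j \<noteq> l"
  shows "row_parity \<Lambda> (oa_square n A i j l) = row_parity \<Lambda> (oa_square n A i l j)"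
proof -
  have "finite \<Lambda>" using assms(1) by (simp add: orthogonal_array_def)
  then show ?thesis
    using assms row_parity_oa_square[OF assms(1)]
    by (auto intro!: relative_parity_sym bij_betw_column_pair[OF assms(1)])
qed

text \<open>For fixed \<open>i\<close> this is the cocycle condition that later makes the signs
  factor.\<close>

lemma row_parity_oa_square_trans:
  assumes "orthogonal_array \<Lambda> k n A" "i < k" "j < k" "l < k" "m < k"
    "i \<noteq> j" "i \<noteq> l" "i \<noteq> m" "j \<noteq> l" "j \<noteq> m" "l \<noteq> m"
  shows "row_parity \<Lambda> (oa_square n A i j m)
    = row_parity \<Lambda> (oa_square n A i j l) + row_parity \<Lambda> (oa_square n A i l m)"
proof -
  have "finite \<Lambda>" using assms(1) by (simp add: orthogonal_array_def)
  then show ?thesis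
    using assms row_parity_oa_square[OF assms(1)]
    by (auto intro!: relative_parity_trans bij_betw_column_pair[OF assms(1)] simp del: add_bit_eq_xor)
qed

text \<open>The pairs of columns are traversed in the order
  \<open>ij, il, li, lj, jl, ji, ij\<close>: every other step is a coordinate swap.\<close>

lemma row_parity_oa_square_sum:
  assumes oa: "orthogonal_array \<Lambda> k n A" and "i < k" "j < k" "l < k" "i \<noteq> j" "i \<noteq> l" "j \<noteq> l"
  shows "row_parity \<Lambda> (oa_square n A i j l) + row_parity \<Lambda> (oa_square n A j i l)
    + row_parity \<Lambda> (oa_square n A l i j) = of_nat (n choose 2)"
proof -
  let ?P = "\<lambda>a b c d. relative_parity {..<n^2} (\<Lambda> \<times> \<Lambda>) (column_pair A a b) (column_pair A c d)"
  let ?R = "\<lambda>i j l. row_parity \<Lambda> (oa_square n A i j l)"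
  have fin: "finite (\<Lambda> \<times> \<Lambda>)" using oa by (simp add: orthogonal_array_def)
  note bij = bij_betw_column_pair[OF oa]
  \<comment> \<open>The start stays at \<open>i, j\<close>, so each use peels the last step off the
    closed walk.\<close>
  have trans: "?P i j c d = ?P i j a b + ?P a b c d"
    if "a < k" "b < k" "a \<noteq> b" "c < k" "d < k" "c \<noteq> d" for a b c d
    using assms that by (intro relative_parity_trans[OF fin] bij) auto
  have R: "?P i j i l = ?R i j l" "?P l i l j = ?R l i j" "?P j l j i = ?R j i l"
    using assms row_parity_oa_square[OF oa] row_parity_oa_square_sym[OF oa, of j l i] by auto
  have c: "?P i l l i = of_nat (n choose 2)" "?P l j j l = of_nat (n choose 2)"
    "?P j i i j = of_nat (n choose 2)"
    using assms by (auto intro!: relative_parity_swap[OF oa])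
  have "0 = ?P i j i j" using assms by (intro relative_parity_refl[symmetric] bij)
  also have "\<dots> = ?P i j i l + ?P i l l i + ?P l i l j + ?P l j j l + ?P j l j i + ?P j i i j"
    using assms trans[of j i i j] trans[of j l j i] trans[of l j j l] trans[of l i l j] trans[of i l l i]
    by simp
  \<comment> \<open>The three swaps contribute three equal bits, which modulo 2 amount to one, and
    moving it across the equation costs no sign.\<close>
  finally show ?thesis
    unfolding R c
    by (cases "?R i j l"; cases "?R j i l"; cases "?R l i j"; cases "of_nat (n choose 2) :: bit") auto
qed

section \<open>Counting triples\<close>

lemma finite_column_triples: "finite (column_triples k)"
  by (rule finite_subset[of _ "{..<k} \<times> {..<k} \<times> {..<k}"]) (auto simp: column_triples_def)

text \<open>Every ordered triple of distinct indices arises from exactly one increasing triple by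
  exactly one of the six rearrangements listed in \<open>?p\<close>.\<close>

lemma sum_distinct_triples:
  fixes g :: "nat \<Rightarrow> nat \<Rightarrow> nat \<Rightarrow> 'b::comm_monoid_add"
  shows "(\<Sum>i<k. \<Sum>j\<in>{..<k} - {i}. \<Sum>l\<in>{..<k} - {i, j}. g i j l)
    = (\<Sum>(i, j, l)\<in>column_triples k. g i j l + g i l j + g j i l + g j l i + g l i j + g l j i)"
proof -
  let ?T = "column_triples k"
  let ?D = "SIGMA i:{..<k}. SIGMA j:{..<k} - {i}. {..<k} - {i, j}"
  let ?g = "\<lambda>(i, j, l). g i j l"
  let ?p = "[\<lambda>(i, j, l). (i, j, l), \<lambda>(i, j, l). (i, l, j), \<lambda>(i, j, l). (j, i, l),
     \<lambda>(i, j, l). (j, l, i), \<lambda>(i, j, l). (l, i, j), \<lambda>(i, j, l). (l, j, i)]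
     :: (nat \<times> nat \<times> nat \<Rightarrow> nat \<times> nat \<times> nat) list"
  have inj: "inj_on (?p ! m) ?T" if "m < 6" for m
    using that by (auto simp: inj_on_def less_Suc_eq numeral_eq_Suc)
  have "(\<Sum>i<k. \<Sum>j\<in>{..<k} - {i}. \<Sum>l\<in>{..<k} - {i, j}. g i j l) = sum ?g ?D"
    by (simp add: sum.Sigma case_prod_unfold)
  also have "?D = (\<Union>m<6. (?p ! m) ` ?T)"
  proof (intro equalityI subsetI)
    fix t assume "t \<in> ?D"
    then obtain i j l where t: "t = (i, j, l)" and d: "i < k" "j < k" "l < k" "i \<noteq> j" "i \<noteq> l" "j \<noteq> l"
      by auto
    consider "i < j" "j < l" | "i < l" "l < j" | "j < i" "i < l" | "j < l" "l < i"
      | "l < i" "i < j" | "l < j" "j < i"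
      using d by linarith
    then show "t \<in> (\<Union>m<6. (?p ! m) ` ?T)"
      unfolding t using d
      by cases (auto simp: column_triples_def numeral_eq_Suc lessThan_Suc image_iff)
  qed (auto simp: column_triples_def numeral_eq_Suc lessThan_Suc)
  also have "sum ?g \<dots> = (\<Sum>m<6. sum ?g ((?p ! m) ` ?T))"
  proof (rule sum.UNION_disjoint)
    show "\<forall>m\<in>{..<6}. \<forall>m'\<in>{..<6}. m \<noteq> m' \<longrightarrow> (?p ! m) ` ?T \<inter> (?p ! m') ` ?T = {}"
      by (auto simp: column_triples_def numeral_eq_Suc lessThan_Suc)
  qed (auto simp: finite_column_triples)
  also have "\<dots> = (\<Sum>m<6. \<Sum>t\<in>?T. ?g ((?p ! m) t))"
    by (rule sum.cong[OF refl]) (simp only: sum.reindex[OF inj] lessThan_iff o_def)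
  also have "\<dots> = (\<Sum>t\<in>?T. \<Sum>m<6. ?g ((?p ! m) t))" by (rule sum.swap)
  also have "\<dots> = (\<Sum>(i, j, l)\<in>?T. g i j l + g i l j + g j i l + g j l i + g l i j + g l j i)"
    by (intro sum.cong refl) (auto simp: numeral_eq_Suc ac_simps)
  finally show ?thesis .
qed

text \<open>Over the reals there is no truncated subtraction, so this also holds for
  \<open>k < 3\<close>, where both sides vanish.\<close>

lemma six_choose_three: "6 * real (k choose 3) = real k * (real k - 1) * (real k - 2)"
proof (induction k)
  case (Suc k)
  have "2 * real (k choose 2) = real k * (real k - 1)"
    by (induction k) (auto simp: numeral_2_eq_2 algebra_simps)
  moreover have "Suc k choose 3 = (k choose 2) + (k choose 3)"
    by (simp add: numeral_3_eq_3 numeral_2_eq_2)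
  ultimately show ?case using Suc by (simp add: algebra_simps)
qed simp

lemma card_column_triples: "real (card (column_triples k)) = real (k choose 3)"
proof -
  have "6 * real (card (column_triples k))
      = (\<Sum>i<k. \<Sum>j\<in>{..<k} - {i}. \<Sum>l\<in>{..<k} - {i, j}. 1)"
    unfolding sum_distinct_triples by (simp add: case_prod_unfold)
  also have "\<dots> = (\<Sum>i<k. \<Sum>j\<in>{..<k} - {i}. real k - 2)"
    by (intro sum.cong refl) (auto simp: card_Diff_subset)
  also have "\<dots> = real k * (real k - 1) * (real k - 2)"
    by (cases k) auto
  finally show ?thesis using six_choose_three[of k] by simp
qed

text \<open>With the diagonal added, the double sum is the square of the sum of the
  \<open>\<sigma> j\<close>, hence nonnegative; the diagonal itself is
  \<open>card B\<close>.\<close>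

lemma sum_sign_products:
  fixes \<sigma> :: "'b \<Rightarrow> real"
  assumes "finite B" "\<And>j. j \<in> B \<Longrightarrow> (\<sigma> j)\<^sup>2 = 1"
  shows "(\<Sum>j\<in>B. \<Sum>l\<in>B - {j}. \<sigma> j * \<sigma> l) \<ge> - real (card B)"
proof -
  have "(\<Sum>l\<in>B - {j}. \<sigma> j * \<sigma> l) = (\<Sum>l\<in>B. \<sigma> j * \<sigma> l) - 1" if "j \<in> B" for j
    using assms that by (simp add: sum_diff1 power2_eq_square)
  then have "(\<Sum>j\<in>B. \<Sum>l\<in>B - {j}. \<sigma> j * \<sigma> l) = (\<Sum>j\<in>B. \<Sum>l\<in>B. \<sigma> j * \<sigma> l) - real (card B)"
    by (simp add: sum_subtractf)
  also have "(\<Sum>j\<in>B. \<Sum>l\<in>B. \<sigma> j * \<sigma> l) = (\<Sum>j\<in>B. \<sigma> j)\<^sup>2"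
    by (simp add: power2_eq_square sum_product)
  finally show ?thesis by simp
qed

section \<open>Signs of bits and the count of triples with equal bits\<close>

definition bit_sign :: "bit \<Rightarrow> real" where
  "bit_sign b = (if b = 0 then 1 else - 1)"

lemma bit_sign_add: "bit_sign (a + b) = bit_sign a * bit_sign b"
  by (cases a; cases b) (auto simp: bit_sign_def)

text \<open>The sum of all signs over ordered triples of distinct indices is evaluated twice:
  grouped by \<open>i\<close> it is at least \<open>- k * (k - 1)\<close>, and grouped by increasing
  triples it is \<open>2 * (k choose 3)\<close> minus 8 for each triple with equal bits.\<close>

lemma equal_bits_count:
  fixes R :: "nat \<Rightarrow> nat \<Rightarrow> nat \<Rightarrow> bit"
  assumes sym: "\<And>i j l. \<lbrakk>i < k; j < k; l < k; i \<noteq> j; i \<noteq> l; j \<noteq> l\<rbrakk> \<Longrightarrow> R i j l = R i l j"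
    and trans: "\<And>i j l m. \<lbrakk>i < k; j < k; l < k; m < k; i \<noteq> j; i \<noteq> l; i \<noteq> m; j \<noteq> l; j \<noteq> m; l \<noteq> m\<rbrakk>
      \<Longrightarrow> R i j m = R i j l + R i l m"
    and odd_sum: "\<And>i j l. \<lbrakk>i < k; j < k; l < k; i \<noteq> j; i \<noteq> l; j \<noteq> l\<rbrakk>
      \<Longrightarrow> R i j l + R j i l + R l i j = 1"
  shows "8 * real (card {(i, j, l) \<in> column_triples k. R i j l = R j i l \<and> R j i l = R l i j})
    \<le> 2 * real (k choose 3) + real k * (real k - 1)"
proof -
  let ?s = "\<lambda>i j l. bit_sign (R i j l)"
  let ?T = "column_triples k"
  let ?Q = "\<lambda>(i, j, l). R i j l = R j i l \<and> R j i l = R l i j"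
  have local_bound: "(\<Sum>j\<in>{..<k} - {i}. \<Sum>l\<in>{..<k} - {i, j}. ?s i j l) \<ge> - (real k - 1)"
    if "i < k" for i
  proof (cases "{..<k} - {i} = {}")
    case True
    then show ?thesis using that by (simp only: sum.empty)
  next
    case False
    then obtain b where b: "b < k" "b \<noteq> i" by auto
    \<comment> \<open>A potential for the cocycle with base point \<open>b\<close>. The value 1 at
      \<open>b\<close> is set separately because the hypotheses say nothing about
      \<open>R i b b\<close>.\<close>
    define \<sigma> where "\<sigma> j = (if j = b then 1 else ?s i b j)" for j
    have "?s i j l = \<sigma> j * \<sigma> l" if jl: "j \<in> {..<k} - {i}" "l \<in> {..<k} - {i} - {j}" for j l
    proof -
      consider "j = b" | "l = b" | "j \<noteq> b" "l \<noteq> b" by blast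
      then show ?thesis
      proof cases
        case 2
        then show ?thesis using jl b \<open>i < k\<close> sym[of i j b] by (auto simp: \<sigma>_def)
      next
        case 3
        then have "R i j l = R i b j + R i b l"
          using jl b \<open>i < k\<close> sym[of i j b] trans[of i j b l] by auto
        then show ?thesis using 3 by (simp add: \<sigma>_def bit_sign_add del: add_bit_eq_xor)
      qed (use jl in \<open>auto simp: \<sigma>_def\<close>)
    qed
    then have "(\<Sum>j\<in>{..<k} - {i}. \<Sum>l\<in>{..<k} - {i, j}. ?s i j l)
        = (\<Sum>j\<in>{..<k} - {i}. \<Sum>l\<in>{..<k} - {i} - {j}. \<sigma> j * \<sigma> l)"
      by (intro sum.cong) auto
    also have "\<dots> \<ge> - real (card ({..<k} - {i}))"
      by (rule sum_sign_products) (auto simp: \<sigma>_def bit_sign_def)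
    finally show ?thesis using that by (simp add: of_nat_diff)
  qed
  \<comment> \<open>By symmetry each of three signs occurs twice. An odd sum leaves one or three
    bits equal to 1: three give -6, one gives 2.\<close>
  have triple: "?s i j l + ?s i l j + ?s j i l + ?s j l i + ?s l i j + ?s l j i
      = 2 - 8 * of_bool (?Q (i, j, l))" if "(i, j, l) \<in> ?T" for i j l
  proof -
    have d: "i < k" "j < k" "l < k" "i \<noteq> j" "i \<noteq> l" "j \<noteq> l"
      using that by (auto simp: column_triples_def)
    have s: "R i l j = R i j l" "R j l i = R j i l" "R l j i = R l i j"
      using d sym by auto
    show ?thesis
      using odd_sum[OF d] unfolding s
      by (cases "R i j l"; cases "R j i l"; cases "R l i j") (auto simp: bit_sign_def)
  qed
  have "- (real k * (real k - 1)) = (\<Sum>i<k. - (real k - 1))" by (simp add: algebra_simps)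
  also have "\<dots> \<le> (\<Sum>i<k. \<Sum>j\<in>{..<k} - {i}. \<Sum>l\<in>{..<k} - {i, j}. ?s i j l)"
    using local_bound by (intro sum_mono) auto
  also have "\<dots> = (\<Sum>t\<in>?T. 2 - 8 * of_bool (?Q t))"
    unfolding sum_distinct_triples
  proof (rule sum.cong[OF refl])
    fix t assume t: "t \<in> ?T"
    obtain i j l where "t = (i, j, l)" by (cases t)
    then show "(case t of (i, j, l) \<Rightarrow> ?s i j l + ?s i l j + ?s j i l + ?s j l i + ?s l i j + ?s l j i)
        = 2 - 8 * of_bool (?Q t)"
      using triple[of i j l] t by (simp only: prod.case)
  qed
  also have "\<dots> = 2 * real (card ?T) - 8 * (\<Sum>t\<in>?T. of_bool (?Q t))"
    by (simp add: sum_subtractf sum_distrib_left)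
  also have "(\<Sum>t\<in>?T. of_bool (?Q t)) = real (card {t \<in> ?T. ?Q t})"
    using finite_column_triples[of k] by (simp add: Int_def)
  also have "{t \<in> ?T. ?Q t} = {(i, j, l) \<in> ?T. R i j l = R j i l \<and> R j i l = R l i j}"
    by auto
  finally show ?thesis by (simp add: card_column_triples)
qed

section \<open>The residue of \<open>n\<close> modulo 4 and the asymptotic bound\<close>

lemma odd_choose_two:
  fixes n :: nat
  assumes "n mod 4 = 2 \<or> n mod 4 = 3"
  shows "odd (n choose 2)"
proof -
  define q where "q = n div 4"
  have "n = 4 * q + 2 \<or> n = 4 * q + 3"
    using assms unfolding q_def by presburger
  \<comment> \<open>Cancelling the 2 in \<open>n * (n - 1) / 2\<close> leaves two odd
    factors.\<close>
  then have "n choose 2 = (2 * q + 1) * (4 * q + 1) \<or> n choose 2 = (4 * q + 3) * (2 * q + 1)"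
    by (auto simp: choose_two algebra_simps)
  then show ?thesis by auto
qed

text \<open>After division by 8 this is a quarter of all triples plus an error quadratic in
  \<open>k\<close>, while the number of triples is cubic.\<close>

lemma equiparity_oa_square_count:
  assumes oa: "orthogonal_array \<Lambda> k n A" and n: "n mod 4 = 2 \<or> n mod 4 = 3"
  shows "8 * real (card {(i, j, l) \<in> column_triples k. equiparity \<Lambda> (oa_square n A i j l)})
    \<le> 2 * real (k choose 3) + real k * (real k - 1)"
proof -
  let ?R = "\<lambda>i j l. row_parity \<Lambda> (oa_square n A i j l)"
  have one: "of_nat (n choose 2) = (1 :: bit)"
    using odd_choose_two[OF n] even_of_nat[where 'a = bit, of "n choose 2"]
    by (cases "of_nat (n choose 2) :: bit") auto
  have "equiparity \<Lambda> (oa_square n A i j l) \<longleftrightarrow> ?R i j l = ?R j i l \<and> ?R j i l = ?R l i j"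
    if "(i, j, l) \<in> column_triples k" for i j l
    using that symbol_parity_oa_square[OF oa, of i j l]
    by (auto simp: equiparity_def column_parity_oa_square column_triples_def)
  then have "{(i, j, l) \<in> column_triples k. equiparity \<Lambda> (oa_square n A i j l)}
      = {(i, j, l) \<in> column_triples k. ?R i j l = ?R j i l \<and> ?R j i l = ?R l i j}"
    by auto
  moreover have "8 * real (card {(i, j, l) \<in> column_triples k. ?R i j l = ?R j i l \<and> ?R j i l = ?R l i j})
      \<le> 2 * real (k choose 3) + real k * (real k - 1)"
  proof (rule equal_bits_count)
    show "?R i j l + ?R j i l + ?R l i j = 1"
      if "i < k" "j < k" "l < k" "i \<noteq> j" "i \<noteq> l" "j \<noteq> l" for i j l
      using row_parity_oa_square_sum[OF oa that] one by (simp only:)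
  qed (fact row_parity_oa_square_sym[OF oa] row_parity_oa_square_trans[OF oa])+
  ultimately show ?thesis by (simp only:)
qed

theorem theorem6p6:
  shows "\<forall>\<epsilon>::real. \<epsilon> > 0 \<longrightarrow>
    (\<exists>K0::nat. \<forall>n k::nat. n \<ge> K0 \<longrightarrow> k \<ge> K0 \<longrightarrow> 3 \<le> k \<longrightarrow> k \<le> n + 1 \<longrightarrow>
       n mod 4 = 2 \<or> n mod 4 = 3 \<longrightarrow>
       (\<forall>(\<Lambda>::'a set) A. orthogonal_array \<Lambda> k n A \<longrightarrow>
          real (card {(i, j, l) \<in> column_triples k. equiparity \<Lambda> (oa_square n A i j l)})
            \<le> (1 / 4 + \<epsilon>) * real (k choose 3)))"
proof (intro allI impI)
  fix \<epsilon> :: real assume "\<epsilon> > 0"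
  \<comment> \<open>The error \<open>k * (k - 1) / 8\<close> is at most \<epsilon> times
    \<open>k * (k - 1) * (k - 2) / 6\<close> as soon as \<open>k - 2\<close> reaches
    \<open>3 / (4 * \<epsilon>)\<close>.\<close>
  obtain K0 :: nat where K0: "3 / (4 * \<epsilon>) + 2 \<le> real K0" using real_arch_simple by blast
  show "\<exists>K0::nat. \<forall>n k::nat. n \<ge> K0 \<longrightarrow> k \<ge> K0 \<longrightarrow> 3 \<le> k \<longrightarrow> k \<le> n + 1 \<longrightarrow>
       n mod 4 = 2 \<or> n mod 4 = 3 \<longrightarrow>
       (\<forall>(\<Lambda>::'a set) A. orthogonal_array \<Lambda> k n A \<longrightarrow>
          real (card {(i, j, l) \<in> column_triples k. equiparity \<Lambda> (oa_square n A i j l)})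
            \<le> (1 / 4 + \<epsilon>) * real (k choose 3))"
  proof (intro exI allI impI)
    fix n k :: nat and \<Lambda> :: "'a set" and A
    assume k: "K0 \<le> k" "3 \<le> k" and n: "n mod 4 = 2 \<or> n mod 4 = 3"
      and oa: "orthogonal_array \<Lambda> k n A"
    have "3 / (4 * \<epsilon>) \<le> real k - 2" using K0 k by linarith
    then have "3 \<le> 4 * \<epsilon> * (real k - 2)" using \<open>\<epsilon> > 0\<close> by (simp add: field_simps)
    then have "3 * (real k * (real k - 1)) \<le> 4 * \<epsilon> * (real k - 2) * (real k * (real k - 1))"
      using k by (intro mult_right_mono) auto
    also have "\<dots> = 4 * \<epsilon> * (6 * real (k choose 3))"
      unfolding six_choose_three by (simp only: ac_simps)
    finally show "real (card {(i, j, l) \<in> column_triples k. equiparity \<Lambda> (oa_square n A i j l)})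
        \<le> (1 / 4 + \<epsilon>) * real (k choose 3)"
      using equiparity_oa_square_count[OF oa n] by (simp add: algebra_simps)
  qed
qed

end
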